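(* Let $G_3(z)=\sum_{k=0}^{\infty}\dfrac{z^{3^k}}{1-z^{3^k}}$ and $F_3(z)=\sum_{k=0}^{\infty}\dfrac{z^{3^k}}{1+z^{3^k}}$ for $|z|<1$. Then for every integer $b\ge2$, \[\mu\left(G_3\left(\tfrac1b\right),F_3\left(\tfrac1b\right)\right)\le\tfrac{36}{19}.\] Moreover, if $a/b\in\mathbb{Q}$ with $a,b$ integers, $b\ge2$, $\log|a|=\lambda\log b$ and $0\le\lambda<19/29$, then \[\mu\left(G_3\left(\tfrac ab\right),F_3\left(\tfrac ab\right)\right)\le\frac{36(1-\lambda)}{19-29\lambda}.\]
   Context: For real numbers $\alpha_1,\dots,\alpha_n$, the simultaneous approximation exponent $\mu(\alpha_1,\dots,\alpha_n)$ is the supremum of the real numbers $\mu$ such that the inequality $\max_{1\le i\le n}|\alpha_i-p_i/q|<q^{-\mu}$ has infinitely many solutions in rational numbers $p_i/q$ (with common denominator $q\ge1$). *)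

theory Defs
  imports Complex_Main "HOL-Library.Extended_Real"
begin

definition sim_approx_exp :: "real list \<Rightarrow> ereal" where
  "sim_approx_exp \<alpha>s = Sup {ereal \<mu> | \<mu>.
      infinite {(ps :: int list, q :: int). q \<ge> 1 \<and> length ps = length \<alpha>s \<and>
        (\<forall>i < length \<alpha>s. \<bar>\<alpha>s ! i - real_of_int (ps ! i) / real_of_int q\<bar>
                              < real_of_int q powr (- \<mu>))}}"

definition G3 :: "real \<Rightarrow> real" where
  "G3 z = (\<Sum>k. z ^ (3 ^ k) / (1 - z ^ (3 ^ k)))"

definition F3 :: "real \<Rightarrow> real" where
  "F3 z = (\<Sum>k. z ^ (3 ^ k) / (1 + z ^ (3 ^ k)))"

end

(*
  Put U(z) = G3(z) - G3(z^2) and V(z) = G3(z^2), so that G3 = U + V and F3 = U - V on the unit disc.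
  Both satisfy Mahler equations S(z) = (rational function with denominator 1 - z^2) + S(z^3).
  Take a Hermite-Pade form L = A0 + A1 U + A2 V with integer polynomials and exact order m at 0, and
  evaluate it at w = r^(3^k), r = a/b.  The functional equations turn L(w), after clearing
  denominators, into an integer linear form in 1, G3(r), F3(r) with coefficients of size b^X and with
  value of exact size b^(-E), where X + E = t m 3^k and |r| = b^(-t).

  One linear form is enough to deal with one denominator q: choose the first form with q |form| < 1/2
  and replace the two numbers by p1/q, p2/q.  The integer s obtained after multiplying by q is either
  nonzero, and then q^(1 - mu) b^X is bounded below, or zero, and then the lower bound for the form
  itself bounds q^(-mu) b^(X + E) below.  In neither case is linear independence of several forms
  needed.  Six explicit forms, at suitably staggered levels k, keep the ratios of consecutive sizes
  small enough for 36 t / (29 t - 10), t = 1 - lambda.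
*)

theory Submission
  imports Defs "HOL-Computational_Algebra.Polynomial"
begin

section \<open>From linear forms to the approximation exponent\<close>

text \<open>Solutions with bounded denominator are finite in number: since \<open>M \<ge> 0\<close>,
  the error is at most 1, so a bound for q also bounds both numerators. An exponent above
  \<open>M\<close> therefore never enters the supremum.\<close>

lemma sim_approx_exp_leI:
  fixes \<alpha> \<beta> M :: real
  assumes M: "M \<ge> 0"
    and bd: "\<And>\<mu>. \<mu> > M \<Longrightarrow> \<exists>K. \<forall>p1 p2 q :: int. q \<ge> 1 \<longrightarrow>
      \<bar>\<alpha> - of_int p1 / of_int q\<bar> < of_int q powr (- \<mu>) \<longrightarrow>
      \<bar>\<beta> - of_int p2 / of_int q\<bar> < of_int q powr (- \<mu>) \<longrightarrow> of_int q \<le> (K::real)"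
  shows "sim_approx_exp [\<alpha>, \<beta>] \<le> ereal M"
  unfolding sim_approx_exp_def
proof (rule Sup_least, clarify)
  fix \<mu> :: real
  let ?S = "{(ps :: int list, q :: int). q \<ge> 1 \<and> length ps = length [\<alpha>, \<beta>] \<and>
        (\<forall>i < length [\<alpha>, \<beta>]. \<bar>[\<alpha>, \<beta>] ! i - real_of_int (ps ! i) / real_of_int q\<bar>
                              < real_of_int q powr (- \<mu>))}"
  assume inf: "infinite ?S"
  show "ereal \<mu> \<le> ereal M"
  proof (rule ccontr)
    assume "\<not> ?thesis"
    hence mu: "\<mu> > M" by simp
    then obtain K where K: "\<forall>p1 p2 q :: int. q \<ge> 1 \<longrightarrow>
      \<bar>\<alpha> - of_int p1 / of_int q\<bar> < of_int q powr (- \<mu>) \<longrightarrow>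
      \<bar>\<beta> - of_int p2 / of_int q\<bar> < of_int q powr (- \<mu>) \<longrightarrow> of_int q \<le> (K::real)"
      using bd by blast
    define H where "H = \<lceil>\<bar>K\<bar> * (\<bar>\<alpha>\<bar> + \<bar>\<beta>\<bar> + 1)\<rceil>"
    have num: "p \<in> {-H..H}"
      if q: "q \<ge> 1" "of_int q \<le> K" and g: "\<bar>\<gamma>\<bar> \<le> \<bar>\<alpha>\<bar> + \<bar>\<beta>\<bar>"
        and d: "\<bar>\<gamma> - of_int p / of_int q\<bar> < of_int q powr (- \<mu>)" for p q :: int and \<gamma> :: real
    proof -
      have "of_int q powr (- \<mu>) \<le> (1::real)"
        using q(1) M mu by (subst powr_minus) (simp add: field_simps ge_one_powr_ge_zero)
      hence "\<bar>of_int p / of_int q\<bar> \<le> \<bar>\<alpha>\<bar> + \<bar>\<beta>\<bar> + 1" using d g by linarith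
      moreover have "\<bar>real_of_int p\<bar> = real_of_int q * \<bar>of_int p / of_int q\<bar>" using q(1) by simp
      moreover have "real_of_int q * \<bar>of_int p / of_int q\<bar> \<le> \<bar>K\<bar> * (\<bar>\<alpha>\<bar> + \<bar>\<beta>\<bar> + 1)"
        using q by (intro mult_mono calculation(1)) linarith+
      ultimately have "\<bar>real_of_int p\<bar> \<le> \<bar>K\<bar> * (\<bar>\<alpha>\<bar> + \<bar>\<beta>\<bar> + 1)"
        by linarith
      hence "real_of_int \<bar>p\<bar> \<le> real_of_int H"
        unfolding H_def using le_of_int_ceiling order_trans by fastforce
      thus ?thesis by (simp only: of_int_le_iff) auto
    qed
    have "?S \<subseteq> {ps. set ps \<subseteq> {-H..H} \<and> length ps = 2} \<times> {1..\<lceil>K\<rceil>}"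
    proof (rule subsetI)
      fix x assume "x \<in> ?S"
      then obtain ps q where x: "x = (ps, q)" and q: "q \<ge> 1"
        and len: "length ps = length [\<alpha>, \<beta>]"
        and *: "\<forall>i < length [\<alpha>, \<beta>]. \<bar>[\<alpha>, \<beta>] ! i - real_of_int (ps ! i) / real_of_int q\<bar>
                              < real_of_int q powr (- \<mu>)" by blast
      from len obtain p1 p2 where ps: "ps = [p1, p2]"
        by (auto simp: length_Suc_conv)
      have d: "\<bar>\<alpha> - of_int p1 / of_int q\<bar> < of_int q powr (- \<mu>)"
              "\<bar>\<beta> - of_int p2 / of_int q\<bar> < of_int q powr (- \<mu>)"
        using *[rule_format, of 0] *[rule_format, of 1] by (auto simp: ps)
      hence "of_int q \<le> K" using K q by blast
      with num[OF q this _ d(1)] num[OF q this _ d(2)] q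
      show "x \<in> {ps. set ps \<subseteq> {-H..H} \<and> length ps = 2} \<times> {1..\<lceil>K\<rceil>}"
        by (simp add: x ps le_ceiling_iff)
    qed
    moreover have "finite ({ps. set ps \<subseteq> {-H..H} \<and> length ps = 2} \<times> {1..\<lceil>K\<rceil>})"
      by (intro finite_cartesian_product finite_lists_length_eq) auto
    ultimately show False using inf finite_subset by blast
  qed
qed

text \<open>\<open>X j\<close> is the exponent of the coefficients and \<open>E j\<close> that of
  the value. \<open>step1\<close> serves the case of a nonzero integer \<open>s\<close>,
  \<open>step2\<close> the case \<open>s = 0\<close>. Both compare form \<open>Suc j\<close> with
  \<open>E j\<close>, because the choice of the form gives b^(E j) \<le> 2 C Q.\<close>

lemma sim_approx_exp_le_linear_forms:
  fixes \<alpha> \<beta> b C M :: real and X E :: "nat \<Rightarrow> real" and c0 c1 c2 :: "nat \<Rightarrow> int"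
  defines "L \<equiv> \<lambda>j. of_int (c0 j) + of_int (c1 j) * \<alpha> + of_int (c2 j) * \<beta>"
  assumes b: "b > 1" and C: "C > 0" and M: "M \<ge> 1"
    and c1: "\<And>j. \<bar>of_int (c1 j)\<bar> \<le> C * b powr X j"
    and c2: "\<And>j. \<bar>of_int (c2 j)\<bar> \<le> C * b powr X j"
    and L_le: "\<And>j. \<bar>L j\<bar> \<le> C * b powr (- E j)"
    and L_ge: "\<And>j. b powr (- E j) \<le> C * \<bar>L j\<bar>"
    and E: "filterlim E at_top sequentially"
    and step1: "\<And>j. X (Suc j) \<le> (M - 1) * E j"
    and step2: "\<And>j. X (Suc j) + E (Suc j) \<le> M * E j"
  shows "sim_approx_exp [\<alpha>, \<beta>] \<le> ereal M"
proof (rule sim_approx_exp_leI)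
  show "M \<ge> 0" using M by simp
next
  fix \<mu> :: real assume mu: "\<mu> > M"
  define K1 where "K1 = max (4 * C * (2 * C) powr (M - 1)) (2 * C * C * (2 * C) powr M)"
  have K1: "K1 > 0" using C by (auto simp: K1_def less_max_iff_disj)
  \<comment> \<open>The first entry covers the denominators for which form 0 is already small, so
    that no preceding form is available.\<close>
  define K where "K = max (b powr E 0 / (2 * C)) (K1 powr (1 / (\<mu> - M)))"
  have "of_int q \<le> K" if q1: "q \<ge> 1"
    and d1: "\<bar>\<alpha> - of_int p1 / of_int q\<bar> < of_int q powr (- \<mu>)"
    and d2: "\<bar>\<beta> - of_int p2 / of_int q\<bar> < of_int q powr (- \<mu>)" for p1 p2 q :: int
  proof (cases "of_int q < b powr E 0 / (2 * C)")
    case True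
    thus ?thesis by (simp add: K_def)
  next
    case False
    define Q where "Q = real_of_int q"
    have Q: "Q \<ge> 1" using q1 by (simp add: Q_def)
    have "\<exists>j. E j > log b (2 * C * Q)"
      using E by (auto simp: filterlim_at_top_dense eventually_sequentially)
    then obtain j0 where "E j0 > log b (2 * C * Q)" by blast
    \<comment> \<open>\<open>P j\<close> guarantees Q |L j| < 1/2 through \<open>L_le\<close>. It
      fails at 0 and holds at \<open>j0\<close>, so it switches on at some \<open>Suc j\<close>,
      whether or not \<open>E\<close> is monotone.\<close>
    define P where "P = (\<lambda>j. 2 * C * Q < b powr E j)"
    have "P j0"
      unfolding P_def using \<open>E j0 > _\<close> b C Q by (subst (asm) log_less_iff) auto
    have "\<not> P 0" using False C by (auto simp: P_def Q_def field_simps)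
    then obtain j where j: "P (Suc j)" "\<not> P j"
      using \<open>P j0\<close> by (induction j0) auto
    have Ej: "b powr E j \<le> 2 * C * Q" using j(2) by (simp add: P_def)
    let ?j = "Suc j"
    have small: "Q * \<bar>L ?j\<bar> < 1 / 2"
    proof -
      have "Q * \<bar>L ?j\<bar> \<le> Q * (C * b powr (- E ?j))" using L_le[of ?j] Q by (intro mult_left_mono) auto
      also have "\<dots> < 1 / 2" using j(1) b unfolding P_def by (simp add: powr_minus field_simps)
      finally show ?thesis .
    qed
    define s where "s = c0 ?j * q + c1 ?j * p1 + c2 ?j * p2"
    define R where "R = of_int (c1 ?j) * (Q * \<alpha> - of_int p1) + of_int (c2 ?j) * (Q * \<beta> - of_int p2)"
    have QL: "Q * L ?j = of_int s + R"
      by (simp add: L_def s_def R_def Q_def algebra_simps)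
    have Qd: "\<bar>Q * \<gamma> - of_int p\<bar> \<le> Q powr (1 - \<mu>)"
      if "\<bar>\<gamma> - of_int p / of_int q\<bar> < of_int q powr (- \<mu>)" for \<gamma> :: real and p :: int
    proof -
      have "\<bar>Q * \<gamma> - of_int p\<bar> = Q * \<bar>\<gamma> - of_int p / Q\<bar>"
        using Q by (subst abs_of_pos[of Q, symmetric]) (auto simp flip: abs_mult simp: field_simps)
      also have "\<dots> \<le> Q * Q powr (- \<mu>)" using that Q by (intro mult_left_mono) (auto simp: Q_def)
      also have "\<dots> = Q powr (1 - \<mu>)" using Q by (simp add: powr_diff powr_minus divide_inverse)
      finally show ?thesis .
    qed
    have R: "\<bar>R\<bar> \<le> 2 * C * b powr X ?j * Q powr (1 - \<mu>)"
    proof -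
      have "\<bar>R\<bar> \<le> (C * b powr X ?j) * Q powr (1 - \<mu>) + (C * b powr X ?j) * Q powr (1 - \<mu>)"
        unfolding R_def by (rule order_trans[OF abs_triangle_ineq])
          (intro add_mono, auto simp: abs_mult intro!: mult_mono c1 c2 Qd[OF d1] Qd[OF d2] mult_nonneg_nonneg less_imp_le[OF C])
      thus ?thesis by (simp add: mult_ac)
    qed
    have "Q powr (\<mu> - M) \<le> K1"
    proof (cases "s = 0")
      \<comment> \<open>A nonzero integer has modulus at least 1 and \<open>Q * L ?j\<close>
        contributes less than 1/2, so the error \<open>R\<close> exceeds 1/2, which forces large
        coefficients.\<close>
      case False
      hence "1 \<le> \<bar>real_of_int s\<bar>" by linarith
      also have "\<dots> \<le> \<bar>Q * L ?j\<bar> + \<bar>R\<bar>" using QL by linarith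
      finally have "1 \<le> 4 * C * b powr X ?j * Q powr (1 - \<mu>)"
        using small R Q by (simp add: abs_mult)
      hence "1 * Q powr (\<mu> - 1) \<le> 4 * C * b powr X ?j * Q powr (1 - \<mu>) * Q powr (\<mu> - 1)"
        by (rule mult_right_mono) auto
      hence "Q powr (\<mu> - 1) \<le> 4 * C * b powr X ?j"
        using Q by (simp add: mult.assoc flip: powr_add)
      also have "\<dots> \<le> 4 * C * b powr ((M - 1) * E j)"
        using step1[of j] b C by (intro mult_left_mono) auto
      also have "\<dots> = 4 * C * (b powr E j) powr (M - 1)" by (simp add: powr_powr mult.commute)
      also have "\<dots> \<le> 4 * C * (2 * C * Q) powr (M - 1)"
        using Ej C M by (intro mult_left_mono powr_mono2) auto
      also have "\<dots> = 4 * C * (2 * C) powr (M - 1) * Q powr (M - 1)"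
        using C Q by (simp add: powr_mult)
      also have "\<dots> \<le> K1 * Q powr (M - 1)"
        unfolding K1_def by (intro mult_right_mono) auto
      finally have "Q powr (\<mu> - 1) / Q powr (M - 1) \<le> K1" using Q by (simp add: field_simps)
      thus ?thesis by (simp flip: powr_diff)
    next
      \<comment> \<open>Now \<open>Q * L ?j\<close> equals the error \<open>R\<close> exactly, and
        the lower bound \<open>L_ge\<close> for the form takes over.\<close>
      case True
      have "b powr (- E ?j) * Q \<le> C * \<bar>L ?j\<bar> * Q"
        using L_ge[of ?j] Q by (intro mult_right_mono) auto
      also have "\<dots> = C * \<bar>R\<bar>"
      proof -
        have "\<bar>Q * L ?j\<bar> = \<bar>R\<bar>" using QL True by simp
        thus ?thesis using Q by (simp add: abs_mult mult_ac)
      qed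
      also have "\<dots> \<le> C * (2 * C * b powr X ?j * Q powr (1 - \<mu>))" using R C by simp
      also have "\<dots> = 2 * C * C * b powr X ?j * (Q / Q powr \<mu>)" using Q by (simp add: powr_diff)
      finally have "Q powr \<mu> \<le> 2 * C * C * (b powr X ?j * b powr E ?j)"
        using Q b by (simp add: powr_minus field_simps)
      also have "\<dots> = 2 * C * C * b powr (X ?j + E ?j)" by (simp add: powr_add)
      also have "\<dots> \<le> 2 * C * C * b powr (M * E j)"
        using step2[of j] b C by (intro mult_left_mono) auto
      also have "\<dots> = 2 * C * C * (b powr E j) powr M" by (simp add: powr_powr mult.commute)
      also have "\<dots> \<le> 2 * C * C * (2 * C * Q) powr M"
        using Ej C M by (intro mult_left_mono powr_mono2) auto
      also have "\<dots> = 2 * C * C * (2 * C) powr M * Q powr M"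
        using C Q by (simp add: powr_mult)
      also have "\<dots> \<le> K1 * Q powr M"
        unfolding K1_def by (intro mult_right_mono) auto
      finally have "Q powr \<mu> / Q powr M \<le> K1" using Q by (simp add: field_simps)
      thus ?thesis by (simp flip: powr_diff)
    qed
    hence "(Q powr (\<mu> - M)) powr (1 / (\<mu> - M)) \<le> K1 powr (1 / (\<mu> - M))"
      using mu by (intro powr_mono2) auto
    hence "Q \<le> K1 powr (1 / (\<mu> - M))" using mu Q by (simp add: powr_powr)
    thus ?thesis by (simp add: K_def Q_def)
  qed
  thus "\<exists>K. \<forall>p1 p2 q :: int. q \<ge> 1 \<longrightarrow>
      \<bar>\<alpha> - of_int p1 / of_int q\<bar> < of_int q powr (- \<mu>) \<longrightarrow>
      \<bar>\<beta> - of_int p2 / of_int q\<bar> < of_int q powr (- \<mu>) \<longrightarrow> of_int q \<le> (K::real)"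
    by blast
qed

text \<open>
  \<open>b ^ (x * 3 ^ n)\<close> is the size of the coefficients and \<open>b ^ (x * 3 ^ n) * \<bar>r\<bar> ^ (m * 3 ^ n)\<close>
  the exact order of magnitude of the \<open>n\<close>-th linear form.
\<close>

definition has_forms :: "real \<Rightarrow> real \<Rightarrow> real \<Rightarrow> real \<Rightarrow> nat \<Rightarrow> nat \<Rightarrow> bool" where
  "has_forms \<alpha> \<beta> b r x m \<longleftrightarrow> (\<exists>C>0. \<forall>\<^sub>F n in sequentially. \<exists>c0 c1 c2 :: int.
     \<bar>of_int c1\<bar> \<le> C * b ^ (x * 3 ^ n) \<and> \<bar>of_int c2\<bar> \<le> C * b ^ (x * 3 ^ n) \<and>
     \<bar>of_int c0 + of_int c1 * \<alpha> + of_int c2 * \<beta>\<bar> \<le> C * (b ^ (x * 3 ^ n) * \<bar>r\<bar> ^ (m * 3 ^ n)) \<and>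
     b ^ (x * 3 ^ n) * \<bar>r\<bar> ^ (m * 3 ^ n) \<le> C * \<bar>of_int c0 + of_int c1 * \<alpha> + of_int c2 * \<beta>\<bar>)"

text \<open>Form number j is family \<open>j mod p\<close> at level \<open>n0 + j div p\<close>. By
  \<open>period\<close>, entry \<open>p\<close> is family 0 one level higher, and all exponents
  scale by 3 with the level, so the inequalities of one cycle imply those for every j.\<close>

lemma sim_approx_exp_le_periodic:
  fixes \<alpha> \<beta> b r t M :: real and x m :: "nat \<Rightarrow> nat" and p :: nat
  assumes b: "b > 1" and r: "\<bar>r\<bar> = b powr (- t)" and M: "M \<ge> 1" and p: "p > 0"
    and forms: "\<And>i. i < p \<Longrightarrow> has_forms \<alpha> \<beta> b r (x i) (m i)"
    and period: "x p = 3 * x 0" "m p = 3 * m 0"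
    and pos: "\<And>i. i < p \<Longrightarrow> t * m i - x i > 0"
    and step1: "\<And>i. i < p \<Longrightarrow> x (Suc i) \<le> (M - 1) * (t * m i - x i)"
    and step2: "\<And>i. i < p \<Longrightarrow> t * m (Suc i) \<le> M * (t * m i - x i)"
  shows "sim_approx_exp [\<alpha>, \<beta>] \<le> ereal M"
proof -
  \<comment> \<open>The body of \<open>has_forms\<close> with its constant exposed: one constant
    must serve all families, which \<open>Q_mono\<close> makes possible.\<close>
  define Q where "Q = (\<lambda>C i n. \<exists>c0 c1 c2 :: int.
     \<bar>of_int c1\<bar> \<le> C * b ^ (x i * 3 ^ n) \<and> \<bar>of_int c2\<bar> \<le> C * b ^ (x i * 3 ^ n) \<and>
     \<bar>of_int c0 + of_int c1 * \<alpha> + of_int c2 * \<beta>\<bar> \<le> C * (b ^ (x i * 3 ^ n) * \<bar>r\<bar> ^ (m i * 3 ^ n)) \<and>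
     b ^ (x i * 3 ^ n) * \<bar>r\<bar> ^ (m i * 3 ^ n) \<le> C * \<bar>of_int c0 + of_int c1 * \<alpha> + of_int c2 * \<beta>\<bar>)"
  have Q_mono: "Q C' i n" if "Q C i n" "C \<le> C'" for C C' i n
  proof -
    have le: "C * y \<le> C' * y" if "y \<ge> 0" for y using that \<open>C \<le> C'\<close> by (rule mult_right_mono[rotated])
    from that(1) obtain c0 c1 c2 :: int where
      "\<bar>of_int c1\<bar> \<le> C * b ^ (x i * 3 ^ n)" "\<bar>of_int c2\<bar> \<le> C * b ^ (x i * 3 ^ n)"
      "\<bar>of_int c0 + of_int c1 * \<alpha> + of_int c2 * \<beta>\<bar> \<le> C * (b ^ (x i * 3 ^ n) * \<bar>r\<bar> ^ (m i * 3 ^ n))"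
      "b ^ (x i * 3 ^ n) * \<bar>r\<bar> ^ (m i * 3 ^ n) \<le> C * \<bar>of_int c0 + of_int c1 * \<alpha> + of_int c2 * \<beta>\<bar>"
      unfolding Q_def by blast
    moreover note le[of "b ^ (x i * 3 ^ n)"] le[of "b ^ (x i * 3 ^ n) * \<bar>r\<bar> ^ (m i * 3 ^ n)"]
      le[of "\<bar>of_int c0 + of_int c1 * \<alpha> + of_int c2 * \<beta>\<bar>"]
    moreover have "b ^ (x i * 3 ^ n) \<ge> 0" "b ^ (x i * 3 ^ n) * \<bar>r\<bar> ^ (m i * 3 ^ n) \<ge> 0" using b by auto
    ultimately show ?thesis
      unfolding Q_def by (intro exI[of _ c0] exI[of _ c1] exI[of _ c2] conjI) linarith+
  qed
  have "\<forall>i\<in>{..<p}. \<exists>C. C > 0 \<and> (\<forall>\<^sub>F n in sequentially. Q C i n)"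
    using forms unfolding has_forms_def Q_def by simp
  from bchoice[OF this]
  obtain f where f: "\<And>i. i < p \<Longrightarrow> f i > 0 \<and> (\<forall>\<^sub>F n in sequentially. Q (f i) i n)"
    by auto
  define C where "C = (\<Sum>i<p. f i)"
  have fC: "f i \<le> C" if "i < p" for i
    unfolding C_def using f that by (intro member_le_sum) (auto intro: less_imp_le)
  have C: "C > 0" using f[OF p] fC[OF p] by linarith
  have "\<forall>\<^sub>F n in sequentially. Q C i n" if "i < p" for i
    using f[OF that] fC[OF that] by (auto elim: eventually_mono intro: Q_mono)
  hence "\<forall>\<^sub>F n in sequentially. \<forall>i\<in>{..<p}. Q C i n"
    by (intro eventually_ball_finite) auto
  then obtain n0 where n0: "\<And>n i. n \<ge> n0 \<Longrightarrow> i < p \<Longrightarrow> Q C i n"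
    by (auto simp: eventually_sequentially)
  define X :: "nat \<Rightarrow> real" where "X = (\<lambda>j. x (j mod p) * 3 ^ (n0 + j div p))"
  define E :: "nat \<Rightarrow> real" where "E = (\<lambda>j. (t * m (j mod p) - x (j mod p)) * 3 ^ (n0 + j div p))"
  have "\<exists>c0 c1 c2 :: int.
     \<bar>of_int c1\<bar> \<le> C * b powr X j \<and> \<bar>of_int c2\<bar> \<le> C * b powr X j \<and>
     \<bar>of_int c0 + of_int c1 * \<alpha> + of_int c2 * \<beta>\<bar> \<le> C * b powr (- E j) \<and>
     b powr (- E j) \<le> C * \<bar>of_int c0 + of_int c1 * \<alpha> + of_int c2 * \<beta>\<bar>" for j
  proof -
    have 1: "b ^ (x (j mod p) * 3 ^ (n0 + j div p)) = b powr X j"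
      using b by (simp add: X_def powr_realpow flip: powr_realpow)
    have "b ^ (x (j mod p) * 3 ^ (n0 + j div p)) * \<bar>r\<bar> ^ (m (j mod p) * 3 ^ (n0 + j div p))
       = b powr X j * (b powr (- t)) powr (m (j mod p) * 3 ^ (n0 + j div p))"
      using b by (simp add: 1 r powr_realpow flip: powr_realpow)
    also have "\<dots> = b powr (- E j)"
      by (simp add: powr_powr E_def X_def algebra_simps flip: powr_add)
    finally have 2: "b ^ (x (j mod p) * 3 ^ (n0 + j div p)) * \<bar>r\<bar> ^ (m (j mod p) * 3 ^ (n0 + j div p))
       = b powr (- E j)" .
    show ?thesis
      using n0[of "n0 + j div p" "j mod p"] p unfolding Q_def 2 unfolding 1 by simp
  qed
  then obtain c0 c1 c2 :: "nat \<Rightarrow> int" where c: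
     "\<And>j. \<bar>of_int (c1 j)\<bar> \<le> C * b powr X j" "\<And>j. \<bar>of_int (c2 j)\<bar> \<le> C * b powr X j"
     "\<And>j. \<bar>of_int (c0 j) + of_int (c1 j) * \<alpha> + of_int (c2 j) * \<beta>\<bar> \<le> C * b powr (- E j)"
     "\<And>j. b powr (- E j) \<le> C * \<bar>of_int (c0 j) + of_int (c1 j) * \<alpha> + of_int (c2 j) * \<beta>\<bar>"
    by metis
  \<comment> \<open>At \<open>j mod p = p - 1\<close> the successor is family 0 one level up; the
    factor 3 in \<open>period\<close> absorbs the change of level.\<close>
  have Suc_j: "X (Suc j) = x (Suc (j mod p)) * 3 ^ (n0 + j div p) \<and>
      E (Suc j) = (t * m (Suc (j mod p)) - x (Suc (j mod p))) * 3 ^ (n0 + j div p)" for j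
    using p by (auto simp: X_def E_def mod_Suc div_Suc period algebra_simps)
  have E_pos: "E j > 0" for j using pos[of "j mod p"] p by (simp add: E_def)
  show ?thesis
  proof (rule sim_approx_exp_le_linear_forms[OF b C M c])
    \<comment> \<open>The smallest unscaled exponent of a value; E j \<ge> e (j div p) drives
      \<open>E\<close> to infinity.\<close>
    define e where "e = Min ((\<lambda>i. t * m i - x i) ` {..<p})"
    have e: "e > 0" unfolding e_def using p pos by (subst Min_gr_iff) auto
    have "e * real (j div p) \<le> E j" for j
    proof -
      have "e \<le> t * m (j mod p) - x (j mod p)" unfolding e_def using p by (intro Min_le) auto
      moreover have "real (j div p) \<le> 3 ^ (n0 + j div p)"
      proof -
        have "j div p < 3 ^ (j div p)" by (rule power_gt_expt) simp
        also have "\<dots> \<le> 3 ^ (n0 + j div p)" by (rule power_increasing) auto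
        finally show ?thesis by (metis less_imp_le of_nat_le_iff of_nat_numeral of_nat_power)
      qed
      ultimately show ?thesis unfolding E_def using e by (intro mult_mono) auto
    qed
    moreover have "filterlim (\<lambda>j. e * real (j div p)) at_top sequentially"
    proof (rule filterlim_tendsto_pos_mult_at_top[OF tendsto_const e])
      show "filterlim (\<lambda>j. real (j div p)) at_top sequentially"
      proof (rule filterlim_compose[OF filterlim_real_sequentially])
        show "filterlim (\<lambda>j. j div p) sequentially sequentially"
          unfolding filterlim_at_top
        proof (intro allI)
          fix Z show "\<forall>\<^sub>F j in sequentially. Z \<le> j div p"
            using p by (intro eventually_sequentiallyI[of "Z * p"]) (simp add: less_eq_div_iff_mult_less_eq)
        qed
      qed
    qed
    ultimately show "filterlim E at_top sequentially"
      by (blast intro: filterlim_at_top_mono always_eventually)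
  next
    fix j
    have jp: "j mod p < p" using p by simp
    have "X (Suc j) \<le> ((M - 1) * (t * m (j mod p) - x (j mod p))) * 3 ^ (n0 + j div p)"
      using step1[OF jp] Suc_j by (auto intro!: mult_right_mono)
    thus "X (Suc j) \<le> (M - 1) * E j" by (simp add: E_def)
    have "X (Suc j) + E (Suc j) = (t * m (Suc (j mod p))) * 3 ^ (n0 + j div p)"
      using Suc_j by (simp add: algebra_simps)
    also have "\<dots> \<le> (M * (t * m (j mod p) - x (j mod p))) * 3 ^ (n0 + j div p)"
      using step2[OF jp] by (auto intro!: mult_right_mono)
    finally show "X (Suc j) + E (Suc j) \<le> M * E j" by (simp add: E_def)
  qed
qed

section \<open>The functions near the origin\<close>

text \<open>Comparison with a geometric series: 3^k \<ge> k + 1, and every denominator has modulus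
  at least 1 - |z|. The explicit bound later yields linear decay at 0.\<close>

lemma summable_G3:
  fixes z :: real
  assumes z: "\<bar>z\<bar> < 1"
  shows "summable (\<lambda>k. z ^ 3 ^ k / (1 - z ^ 3 ^ k))"
    and "\<bar>G3 z\<bar> \<le> \<bar>z\<bar> / (1 - \<bar>z\<bar>)\<^sup>2"
proof -
  have le: "norm (z ^ 3 ^ k / (1 - z ^ 3 ^ k)) \<le> \<bar>z\<bar> / (1 - \<bar>z\<bar>) * \<bar>z\<bar> ^ k" for k
  proof -
    have "Suc k \<le> 3 ^ k" using power_gt_expt[of 3 k] by simp
    hence 1: "\<bar>z\<bar> ^ 3 ^ k \<le> \<bar>z\<bar> ^ Suc k" using z by (intro power_decreasing) auto
    have "\<bar>z\<bar> ^ Suc k \<le> \<bar>z\<bar> * 1"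
      using z unfolding power_Suc by (intro mult_left_mono power_le_one) auto
    hence "1 - \<bar>z\<bar> \<le> 1 - \<bar>z\<bar> ^ 3 ^ k" using 1 by linarith
    also have "\<dots> \<le> \<bar>1 - z ^ 3 ^ k\<bar>" by (simp add: power_abs[symmetric])
    finally have "\<bar>z\<bar> ^ 3 ^ k / \<bar>1 - z ^ 3 ^ k\<bar> \<le> \<bar>z\<bar> ^ Suc k / (1 - \<bar>z\<bar>)"
      using 1 z by (intro frac_le) auto
    thus ?thesis by (simp add: abs_divide power_abs)
  qed
  have sum: "summable (\<lambda>k. \<bar>z\<bar> / (1 - \<bar>z\<bar>) * \<bar>z\<bar> ^ k)"
    using z by (intro summable_mult summable_geometric) auto
  show "summable (\<lambda>k. z ^ 3 ^ k / (1 - z ^ 3 ^ k))"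
    by (rule summable_comparison_test[OF _ sum]) (use le in blast)
  have "\<bar>G3 z\<bar> \<le> (\<Sum>k. \<bar>z\<bar> / (1 - \<bar>z\<bar>) * \<bar>z\<bar> ^ k)"
    unfolding G3_def using norm_suminf_le[OF le sum] by simp
  also have "\<dots> = \<bar>z\<bar> / (1 - \<bar>z\<bar>) * (1 / (1 - \<bar>z\<bar>))"
    using z by (subst suminf_mult) (auto intro: summable_geometric simp: suminf_geometric)
  finally show "\<bar>G3 z\<bar> \<le> \<bar>z\<bar> / (1 - \<bar>z\<bar>)\<^sup>2"
    by (simp add: power2_eq_square)
qed

lemma G3_rec:
  assumes "\<bar>z\<bar> < 1"
  shows "G3 z = z / (1 - z) + G3 (z ^ 3)"
  using suminf_split_head[OF summable_G3(1)[OF assms]]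
  by (simp add: G3_def power_mult mult.commute flip: power_mult)

lemma abs_power_less_one:
  fixes z :: real
  assumes "\<bar>z\<bar> < 1" "n > 0"
  shows "\<bar>z ^ n\<bar> < 1"
  using assms by (simp add: power_abs power_less_one_iff)

lemma square_neq_one:
  fixes y :: real
  assumes "\<bar>y\<bar> < 1"
  shows "1 - y\<^sup>2 \<noteq> 0"
  using abs_power_less_one[OF assms, of 2] by auto

text \<open>Termwise, with y = z^(3^k), this is y/(1 + y) = y/(1 - y) - 2 y^2/(1 - y^2).\<close>

lemma F3_eq_G3:
  assumes z: "\<bar>z\<bar> < 1"
  shows "F3 z = G3 z - 2 * G3 (z\<^sup>2)"
proof -
  have "z ^ 3 ^ k / (1 + z ^ 3 ^ k)
      = z ^ 3 ^ k / (1 - z ^ 3 ^ k) - 2 * ((z\<^sup>2) ^ 3 ^ k / (1 - (z\<^sup>2) ^ 3 ^ k))" for k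
  proof -
    define y where "y = z ^ 3 ^ k"
    have y: "\<bar>y\<bar> < 1" using abs_power_less_one[OF z] by (simp add: y_def)
    have "(z\<^sup>2) ^ 3 ^ k = y\<^sup>2" by (simp add: y_def mult.commute flip: power_mult)
    moreover have "y / (1 + y) = y / (1 - y) - 2 * (y\<^sup>2 / (1 - y\<^sup>2))"
    proof -
      have "1 - y\<^sup>2 = (1 - y) * (1 + y)" by (simp add: power2_eq_square algebra_simps)
      moreover have "1 - y \<noteq> 0" "1 + y \<noteq> 0" using y by linarith+
      ultimately show ?thesis by (simp add: divide_simps) (simp add: power2_eq_square algebra_simps)
    qed
    ultimately show ?thesis by (simp add: y_def)
  qed
  moreover have "summable (\<lambda>k. (z\<^sup>2) ^ 3 ^ k / (1 - (z\<^sup>2) ^ 3 ^ k))"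
    by (rule summable_G3) (use abs_power_less_one[OF z, of 2] in simp)
  hence "(\<lambda>k. z ^ 3 ^ k / (1 - z ^ 3 ^ k) - 2 * ((z\<^sup>2) ^ 3 ^ k / (1 - (z\<^sup>2) ^ 3 ^ k)))
      sums (G3 z - 2 * G3 (z\<^sup>2))"
    unfolding G3_def using summable_G3(1)[OF z] by (intro sums_diff sums_mult summable_sums)
  ultimately show ?thesis
    unfolding F3_def by (simp add: sums_iff)
qed

text \<open>This is the odd part of \<open>G3\<close>, its terms being y/(1 - y^2) with y = z^(3^k);
  \<open>G3_even\<close> is the even part. A Hermite-Pade form of fixed parity then satisfies half
  of its vanishing conditions automatically.\<close>

definition G3_odd :: "real \<Rightarrow> real" where
  "G3_odd z = G3 z - G3 (z\<^sup>2)"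

definition G3_even :: "real \<Rightarrow> real" where
  "G3_even z = G3 (z\<^sup>2)"

lemma G3_even_rec:
  assumes "\<bar>z\<bar> < 1"
  shows "G3_even z = z\<^sup>2 / (1 - z\<^sup>2) + G3_even (z ^ 3)"
  using G3_rec[of "z\<^sup>2"] abs_power_less_one[OF assms, of 2]
  by (simp add: G3_even_def flip: power_mult)

lemma G3_odd_rec:
  assumes z: "\<bar>z\<bar> < 1"
  shows "G3_odd z = z / (1 - z\<^sup>2) + G3_odd (z ^ 3)"
proof -
  have "1 - z\<^sup>2 = (1 - z) * (1 + z)" by (simp add: power2_eq_square algebra_simps)
  hence "z / (1 - z) - z\<^sup>2 / (1 - z\<^sup>2) = z / (1 - z\<^sup>2)"
    using z by (simp add: divide_simps) (simp add: power2_eq_square algebra_simps)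
  thus ?thesis using G3_rec[OF z] G3_even_rec[OF z] by (simp add: G3_odd_def G3_even_def)
qed

lemma cubing_iterate:
  fixes S f :: "real \<Rightarrow> real"
  assumes rec: "\<And>z. \<bar>z\<bar> < 1 \<Longrightarrow> S z = f z + S (z ^ 3)" and z: "\<bar>z\<bar> < 1"
  shows "S z = (\<Sum>j<k. f (z ^ 3 ^ j)) + S (z ^ 3 ^ k)"
proof (induction k)
  case (Suc k)
  with rec[of "z ^ 3 ^ k"] abs_power_less_one[OF z, of "3 ^ k"]
  show ?case by (simp add: mult.commute flip: power_mult)
qed simp

lemma G3_bounded_quotient:
  fixes z :: real
  assumes "\<bar>z\<bar> \<le> 1 / 2"
  shows "\<bar>G3 z\<bar> \<le> 4 * \<bar>z\<bar>"
proof -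
  have "(1 - \<bar>z\<bar>)\<^sup>2 \<ge> (1 / 2)\<^sup>2" using assms by (intro power_mono) auto
  hence "\<bar>z\<bar> / (1 - \<bar>z\<bar>)\<^sup>2 \<le> \<bar>z\<bar> / (1 / 4)"
    by (intro divide_left_mono) (auto simp: power2_eq_square)
  thus ?thesis using summable_G3(2)[of z] assms by simp
qed

section \<open>Taylor expansions to order 26 and the order of a form at 0\<close>

lemma tendsto_power_divide_zero:
  fixes f :: "real \<Rightarrow> real"
  assumes "m < n" "\<And>w. \<bar>w\<bar> \<le> 1 / 2 \<Longrightarrow> \<bar>f w\<bar> \<le> K * \<bar>w\<bar> ^ n"
  shows "((\<lambda>w. f w / w ^ m) \<longlongrightarrow> 0) (at 0)"
proof (rule tendsto_0_le[where K = 1])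
  show "\<forall>\<^sub>F w in at 0. norm (f w / w ^ m) \<le> norm (K * \<bar>w\<bar> ^ (n - m)) * 1"
    unfolding eventually_at
  proof (intro exI[of _ "1/2"] conjI ballI impI)
    fix w :: real assume w: "w \<noteq> 0 \<and> dist w 0 < 1 / 2"
    hence "\<bar>f w\<bar> / \<bar>w\<bar> ^ m \<le> K * \<bar>w\<bar> ^ n / \<bar>w\<bar> ^ m"
      using assms(2)[of w] by (intro divide_right_mono) auto
    also have "\<dots> = K * \<bar>w\<bar> ^ (n - m)" using w assms(1) by (simp add: power_diff)
    also have "\<dots> \<le> norm (K * \<bar>w\<bar> ^ (n - m)) * 1" by simp
    finally show "norm (f w / w ^ m) \<le> norm (K * \<bar>w\<bar> ^ (n - m)) * 1" by (simp add: abs_divide power_abs)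
  qed auto
  have "((\<lambda>w::real. K * \<bar>w\<bar> ^ (n - m)) \<longlongrightarrow> K * \<bar>0\<bar> ^ (n - m)) (at 0)"
    by (intro tendsto_intros)
  thus "((\<lambda>w::real. K * \<bar>w\<bar> ^ (n - m)) \<longlongrightarrow> 0) (at 0)" using assms(1) by (simp add: power_0_left)
qed

text \<open>Serves twice: for splitting off Taylor terms, and for recognising a quotient by 1 - y^2
  as a polynomial in y when denominators at \<open>r\<close> are cleared.\<close>

lemma geometric_even:
  fixes y :: real
  assumes "\<bar>y\<bar> < 1"
  shows "(y ^ e - y ^ (e + 2 * h)) / (1 - y\<^sup>2) = (\<Sum>i<h. y ^ (e + 2 * i))"
proof -
  have "(\<Sum>i<h. y ^ (e + 2 * i)) = y ^ e * (\<Sum>i<h. (y\<^sup>2) ^ i)"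
    by (simp add: sum_distrib_left power_add flip: power_mult)
  also have "\<dots> = y ^ e * ((1 - (y\<^sup>2) ^ h) / (1 - y\<^sup>2))"
    using square_neq_one[OF assms] by (subst sum_gp_strict) auto
  finally show ?thesis by (simp add: power_add algebra_simps flip: power_mult)
qed

lemma geometric_split:
  fixes y :: real
  assumes "\<bar>y\<bar> < 1"
  shows "y ^ e / (1 - y\<^sup>2) = (\<Sum>i<h. y ^ (e + 2 * i)) + y ^ (e + 2 * h) / (1 - y\<^sup>2)"
  using geometric_even[OF assms, of e h] by (simp add: diff_divide_distrib)

text \<open>
  Taylor polynomials of degree 26 at the origin: the coefficient of \<open>z ^ n\<close> in \<open>G3 z\<close> is one plus
  the multiplicity of 3 in \<open>n\<close>.
\<close>

definition G3_odd_poly :: "real poly" where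
  "G3_odd_poly = Poly [0,1,0,2,0,1,0,1,0,3,0,1,0,1,0,2,0,1,0,1,0,2,0,1,0,1,0]"

definition G3_even_poly :: "real poly" where
  "G3_even_poly = Poly [0,0,1,0,1,0,2,0,1,0,1,0,2,0,1,0,1,0,3,0,1,0,1,0,2,0,1]"

text \<open>Three applications of the functional equation leave S(w^27), which is O(w^27) and hence
  negligible against w^26. The three rational terms are expanded as geometric series up to that
  order.\<close>

lemma cubing_expansion:
  fixes S :: "real \<Rightarrow> real" and P :: "real poly"
  assumes rec: "\<And>z. \<bar>z\<bar> < 1 \<Longrightarrow> S z = z ^ e / (1 - z\<^sup>2) + S (z ^ 3)"
    and S_le: "\<And>z. \<bar>z\<bar> \<le> 1 / 2 \<Longrightarrow> \<bar>S z\<bar> \<le> K * \<bar>z\<bar>"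
    and e: "e \<ge> 1"
    and P: "\<And>w. poly P w = (\<Sum>i<13. w ^ (e + 2 * i)) + (\<Sum>i<4. (w ^ 3) ^ (e + 2 * i)) + (w ^ 9) ^ e"
  shows "((\<lambda>w. (S w - poly P w) / w ^ 26) \<longlongrightarrow> 0) (at 0)"
proof -
  have "((\<lambda>w::real. w ^ e / (1 - w\<^sup>2) + w ^ (3 * e - 2) / (1 - (w ^ 3)\<^sup>2) + w ^ (9 * e - 8) / (1 - (w ^ 9)\<^sup>2)) \<longlongrightarrow>
     0 ^ e / (1 - 0\<^sup>2) + 0 ^ (3 * e - 2) / (1 - (0 ^ 3)\<^sup>2) + 0 ^ (9 * e - 8) / (1 - (0 ^ 9)\<^sup>2)) (at 0)"
    by (intro tendsto_intros) auto
  moreover have "((\<lambda>w. S (w ^ 27) / w ^ 26) \<longlongrightarrow> 0) (at 0)"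
  proof (rule tendsto_power_divide_zero[where n = 27 and K = K])
    fix w :: real assume w: "\<bar>w\<bar> \<le> 1 / 2"
    have "\<bar>w ^ 27\<bar> \<le> 1 / 2"
      unfolding power_abs using power_decreasing[of 1 27 "\<bar>w\<bar>"] w by simp
    from S_le[OF this] show "\<bar>S (w ^ 27)\<bar> \<le> K * \<bar>w\<bar> ^ 27" by (simp add: power_abs)
  qed simp
  ultimately have lim: "((\<lambda>w. w ^ e / (1 - w\<^sup>2) + w ^ (3 * e - 2) / (1 - (w ^ 3)\<^sup>2) + w ^ (9 * e - 8) / (1 - (w ^ 9)\<^sup>2)
      + S (w ^ 27) / w ^ 26) \<longlongrightarrow> 0) (at 0)"
    using e tendsto_add by (fastforce simp: power_0_left)
  have "\<forall>\<^sub>F w in at 0. w ^ e / (1 - w\<^sup>2) + w ^ (3 * e - 2) / (1 - (w ^ 3)\<^sup>2) + w ^ (9 * e - 8) / (1 - (w ^ 9)\<^sup>2)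
      + S (w ^ 27) / w ^ 26 = (S w - poly P w) / w ^ 26"
    unfolding eventually_at
  proof (intro exI[of _ 1] conjI ballI impI)
    fix w :: real assume "w \<noteq> 0 \<and> dist w 0 < 1"
    hence w0: "w \<noteq> 0" and w: "\<bar>w\<bar> < 1" by auto
    have w3: "\<bar>w ^ 3\<bar> < 1" "\<bar>w ^ 9\<bar> < 1" using abs_power_less_one[OF w] by auto
    have "{..<3::nat} = {0,1,2}" by auto
    hence "S w = w ^ e / (1 - w\<^sup>2) + (w ^ 3) ^ e / (1 - (w ^ 3)\<^sup>2) + (w ^ 9) ^ e / (1 - (w ^ 9)\<^sup>2) + S (w ^ 27)"
      using cubing_iterate[of S, OF rec w, of 3] by simp
    \<comment> \<open>Keeping 13, 4 and 1 terms makes each remainder w^26 times a positive power of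
      w: the remainders start at e + 26, 3 e + 24 = (3 e - 2) + 26 and 9 e + 18 = (9 e - 8) + 26,
      where e \<ge> 1.\<close>
    moreover have "w ^ e / (1 - w\<^sup>2) = (\<Sum>i<13. w ^ (e + 2 * i)) + w ^ e * w ^ 26 / (1 - w\<^sup>2)"
      using geometric_split[OF w, of e 13] by (simp flip: power_add)
    moreover have "(w ^ 3) ^ e / (1 - (w ^ 3)\<^sup>2) = (\<Sum>i<4. (w ^ 3) ^ (e + 2 * i)) + w ^ (3 * e - 2) * w ^ 26 / (1 - (w ^ 3)\<^sup>2)"
      using geometric_split[OF w3(1), of e 4] e by (simp add: add.commute flip: power_mult power_add)
    moreover have "(w ^ 9) ^ e / (1 - (w ^ 9)\<^sup>2) = (w ^ 9) ^ e + w ^ (9 * e - 8) * w ^ 26 / (1 - (w ^ 9)\<^sup>2)"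
      using geometric_split[OF w3(2), of e 1] e by (simp add: add.commute flip: power_mult power_add)
    ultimately have "S w - poly P w = w ^ e * w ^ 26 / (1 - w\<^sup>2) + w ^ (3 * e - 2) * w ^ 26 / (1 - (w ^ 3)\<^sup>2)
        + w ^ (9 * e - 8) * w ^ 26 / (1 - (w ^ 9)\<^sup>2) + S (w ^ 27)"
      using P[of w] by linarith
    moreover have "a * w ^ 26 / c / w ^ 26 = a / c" for a c using w0 by simp
    ultimately show "w ^ e / (1 - w\<^sup>2) + w ^ (3 * e - 2) / (1 - (w ^ 3)\<^sup>2) + w ^ (9 * e - 8) / (1 - (w ^ 9)\<^sup>2)
      + S (w ^ 27) / w ^ 26 = (S w - poly P w) / w ^ 26"
      by (simp only: add_divide_distrib)
  qed auto
  with lim show ?thesis by (rule Lim_transform_eventually)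
qed

lemma G3_odd_expansion:
  "((\<lambda>w. (G3_odd w - poly G3_odd_poly w) / w ^ 26) \<longlongrightarrow> 0) (at 0)"
proof (rule cubing_expansion[where e = 1 and K = 8])
  fix z :: real assume z: "\<bar>z\<bar> \<le> 1 / 2"
  have "\<bar>z\<^sup>2\<bar> \<le> \<bar>z\<bar>" unfolding power_abs using power_decreasing[of 1 2 "\<bar>z\<bar>"] z by simp
  thus "\<bar>G3_odd z\<bar> \<le> 8 * \<bar>z\<bar>"
    using G3_bounded_quotient[of z] G3_bounded_quotient[of "z\<^sup>2"] z unfolding G3_odd_def by linarith
next
  fix w show "poly G3_odd_poly w = (\<Sum>i<13. w ^ (1 + 2 * i)) + (\<Sum>i<4. (w ^ 3) ^ (1 + 2 * i)) + (w ^ 9) ^ 1"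
    by (simp add: G3_odd_poly_def eval_nat_numeral algebra_simps)
qed (simp_all add: G3_odd_rec)

lemma G3_even_expansion:
  "((\<lambda>w. (G3_even w - poly G3_even_poly w) / w ^ 26) \<longlongrightarrow> 0) (at 0)"
proof (rule cubing_expansion[where e = 2 and K = 4])
  fix z :: real assume z: "\<bar>z\<bar> \<le> 1 / 2"
  have "\<bar>z\<^sup>2\<bar> \<le> \<bar>z\<bar>" unfolding power_abs using power_decreasing[of 1 2 "\<bar>z\<bar>"] z by simp
  thus "\<bar>G3_even z\<bar> \<le> 4 * \<bar>z\<bar>"
    using G3_bounded_quotient[of "z\<^sup>2"] z unfolding G3_even_def by linarith
next
  fix w show "poly G3_even_poly w = (\<Sum>i<13. w ^ (2 + 2 * i)) + (\<Sum>i<4. (w ^ 3) ^ (2 + 2 * i)) + (w ^ 9) ^ 2"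
    by (simp add: G3_even_poly_def eval_nat_numeral algebra_simps)
qed (simp_all add: G3_even_rec)

lemma tendsto_poly_shift:
  fixes P :: "real poly"
  assumes "\<And>i. i < m \<Longrightarrow> coeff P i = 0"
  shows "((\<lambda>w. poly P w / w ^ m) \<longlongrightarrow> coeff P m) (at 0)"
proof -
  have "P = monom 1 m * poly_shift m P"
    using assms by (intro poly_eqI) (auto simp: coeff_monom_mult coeff_poly_shift)
  hence P: "poly P w = w ^ m * poly (poly_shift m P) w" for w
    by (metis mult_1 poly_monom poly_mult)
  have "((\<lambda>w. poly (poly_shift m P) w) \<longlongrightarrow> poly (poly_shift m P) 0) (at 0)"
    by (intro tendsto_intros)
  hence "((\<lambda>w. poly (poly_shift m P) w) \<longlongrightarrow> coeff P m) (at 0)"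
    by (simp add: poly_0_coeff_0 coeff_poly_shift)
  thus ?thesis
    by (rule Lim_transform_eventually) (auto simp: P eventually_at_filter)
qed

text \<open>Replacing both functions by their Taylor polynomials changes the form by o(w^26), so for
  m \<le> 26 the leading term is read off a finite polynomial. A nonzero \<open>coeff P m\<close>
  will give the exact order of magnitude.\<close>

lemma form_tendsto:
  fixes A0 A1 A2 :: "real poly"
  defines "P \<equiv> A0 + A1 * G3_odd_poly + A2 * G3_even_poly"
  assumes m: "m \<le> 26" and P: "\<And>i. i < m \<Longrightarrow> coeff P i = 0"
  shows "((\<lambda>w. (poly A0 w + poly A1 w * G3_odd w + poly A2 w * G3_even w) / w ^ m) \<longlongrightarrow> coeff P m) (at 0)"
proof -
  let ?o = "\<lambda>w. (G3_odd w - poly G3_odd_poly w) / w ^ 26"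
  let ?e = "\<lambda>w. (G3_even w - poly G3_even_poly w) / w ^ 26"
  have "((\<lambda>w. poly P w / w ^ m + w ^ (26 - m) * (poly A1 w * ?o w + poly A2 w * ?e w)) \<longlongrightarrow>
      coeff P m + 0 ^ (26 - m) * (poly A1 0 * 0 + poly A2 0 * 0)) (at 0)"
    by (intro tendsto_intros tendsto_poly_shift P G3_odd_expansion G3_even_expansion)
  hence "((\<lambda>w. poly P w / w ^ m + w ^ (26 - m) * (poly A1 w * ?o w + poly A2 w * ?e w)) \<longlongrightarrow> coeff P m) (at 0)"
    by simp
  thus ?thesis
  proof (rule Lim_transform_eventually)
    have "poly P w / w ^ m + w ^ (26 - m) * (poly A1 w * ?o w + poly A2 w * ?e w) =
        (poly A0 w + poly A1 w * G3_odd w + poly A2 w * G3_even w) / w ^ m" if w: "w \<noteq> 0" for w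
    proof -
      have "w ^ (26 - m) * (x / w ^ 26) = x / w ^ m" for x
        using w m by (simp add: power_diff)
      hence "w ^ (26 - m) * (poly A1 w * ?o w + poly A2 w * ?e w) =
         (poly A1 w * (G3_odd w - poly G3_odd_poly w) + poly A2 w * (G3_even w - poly G3_even_poly w)) / w ^ m"
        by (simp flip: add_divide_distrib)
      thus ?thesis by (simp add: P_def algebra_simps flip: add_divide_distrib)
    qed
    thus "\<forall>\<^sub>F w in at 0. poly P w / w ^ m + w ^ (26 - m) * (poly A1 w * ?o w + poly A2 w * ?e w) =
        (poly A0 w + poly A1 w * G3_odd w + poly A2 w * G3_even w) / w ^ m"
      by (auto simp: eventually_at_filter)
  qed
qed

section \<open>Integer linear forms at rational points\<close>

text \<open>Only an exponent of \<open>b\<close> is tracked: it adds under products and can be kept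
  common in sums. It becomes the coefficient size in \<open>has_forms\<close>.\<close>

definition clears_denom :: "int \<Rightarrow> nat \<Rightarrow> real \<Rightarrow> bool" where
  "clears_denom b n x \<longleftrightarrow> of_int b ^ n * x \<in> \<int>"

lemma clears_denom_mono:
  assumes "clears_denom b n x" "n \<le> n'"
  shows "clears_denom b n' x"
proof -
  have "of_int b ^ n' * x = of_int (b ^ (n' - n)) * (of_int b ^ n * x)"
    using assms(2) by (simp flip: power_add)
  thus ?thesis using assms(1) unfolding clears_denom_def by (metis Ints_mult Ints_of_int)
qed

lemma clears_denom_mult:
  assumes "clears_denom b n x" "clears_denom b n' y"
  shows "clears_denom b (n + n') (x * y)"
proof -
  have "of_int b ^ (n + n') * (x * y) = (of_int b ^ n * x) * (of_int b ^ n' * y)"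
    by (simp add: power_add)
  thus ?thesis using assms unfolding clears_denom_def by (metis Ints_mult)
qed

lemma clears_denom_Ints:
  assumes "x \<in> \<int>"
  shows "clears_denom b n x"
  using assms unfolding clears_denom_def by (metis Ints_mult Ints_of_int of_int_power)

lemma clears_denom_diff: "clears_denom b n x \<Longrightarrow> clears_denom b n y \<Longrightarrow> clears_denom b n (x - y)"
  by (simp add: clears_denom_def right_diff_distrib)

lemma clears_denom_minus: "clears_denom b n x \<Longrightarrow> clears_denom b n (- x)"
  by (simp add: clears_denom_def)

lemma clears_denom_sum: "(\<And>i. i \<in> A \<Longrightarrow> clears_denom b n (f i)) \<Longrightarrow> clears_denom b n (\<Sum>i\<in>A. f i)"
  by (simp add: clears_denom_def sum_distrib_left Ints_sum)

lemma clears_denom_scale: "clears_denom b n x \<Longrightarrow> c \<in> \<int> \<Longrightarrow> clears_denom b n (c * x)"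
  using clears_denom_mult[OF clears_denom_Ints[of c b 0], of n x] by simp

locale rational_point =
  fixes a b :: int and r :: real
  assumes b: "b \<ge> 2" and a: "a \<noteq> 0" and r_def: "r = of_int a / of_int b" and r_less: "\<bar>r\<bar> < 1"
begin

lemma r_nonzero: "r \<noteq> 0"
  using a b by (simp add: r_def)

lemma power_three_tendsto: "(\<lambda>n. r ^ 3 ^ (n + s)) \<longlonglongrightarrow> 0"
proof (rule tendsto_0_le[where K = 1])
  show "(\<lambda>n. r ^ n) \<longlonglongrightarrow> 0" using r_less by (rule LIMSEQ_abs_realpow_zero2)
  show "\<forall>\<^sub>F n in sequentially. norm (r ^ 3 ^ (n + s)) \<le> norm (r ^ n) * 1"
  proof (intro always_eventually allI)
    fix n :: nat
    have "n + s < 3 ^ (n + s)" by (rule power_gt_expt) simp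
    thus "norm (r ^ 3 ^ (n + s)) \<le> norm (r ^ n) * 1"
      using r_less by (simp add: power_abs power_decreasing)
  qed
qed

lemma clears_denom_power: "i \<le> n \<Longrightarrow> clears_denom b n (r ^ i)"
proof (rule clears_denom_mono)
  show "clears_denom b i (r ^ i)"
    using b by (simp add: clears_denom_def r_def power_divide flip: of_int_power)
qed

lemma clears_denom_poly:
  assumes "\<And>i. coeff A i \<in> \<int>" "degree A \<le> d"
  shows "clears_denom b (d * N) (poly A (r ^ N))"
  unfolding poly_altdef using assms
  by (intro clears_denom_sum clears_denom_scale) (auto simp: mult.commute simp flip: power_mult intro!: clears_denom_power)

text \<open>By \<open>geometric_even\<close> the quotient is a sum of powers of r^N with exponents
  at most f - 2. The last hypothesis expresses N (f - 2) \<le> n without subtraction on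
  \<open>nat\<close>.\<close>

lemma clears_denom_geometric:
  assumes "N > 0" "e \<le> f" "even (f - e)" "N * f \<le> n + 2 * N"
  shows "clears_denom b n (((r ^ N) ^ e - (r ^ N) ^ f) / (1 - (r ^ N)\<^sup>2))"
proof -
  from assms obtain h where h: "f = e + 2 * h" by (metis evenE le_add_diff_inverse)
  have "clears_denom b n (\<Sum>i<h. (r ^ N) ^ (e + 2 * i))"
  proof (rule clears_denom_sum)
    fix i assume "i \<in> {..<h}"
    hence "e + 2 * i + 2 \<le> f" using h by simp
    hence "N * (e + 2 * i + 2) \<le> N * f" by (rule mult_le_mono2)
    hence "N * (e + 2 * i) \<le> n" using assms(4) by (simp add: algebra_simps)
    thus "clears_denom b n ((r ^ N) ^ (e + 2 * i))"
      unfolding power_mult[symmetric] by (rule clears_denom_power)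
  qed
  thus ?thesis using geometric_even[OF abs_power_less_one[OF r_less \<open>N > 0\<close>]] by (simp add: h)
qed

text \<open>The form is evaluated at \<open>w n\<close>, and the iterated functional equations carry
  its function values back to \<open>r\<close>; the sum in \<open>int0\<close> is the rational part
  collected on the way. The factor \<open>D n\<close> can clear a common denominator, and tending to
  1 it leaves the orders of magnitude unchanged.\<close>

lemma has_forms_of_poly:
  fixes A0 A1 A2 :: "real poly" and D :: "nat \<Rightarrow> real" and m s x :: nat
  defines "P \<equiv> A0 + A1 * G3_odd_poly + A2 * G3_even_poly"
    and "w \<equiv> \<lambda>n. r ^ 3 ^ (n + s)" and "y \<equiv> \<lambda>j. r ^ 3 ^ j"
  assumes m: "m \<le> 26" and P: "\<forall>i<m. coeff P i = 0" "coeff P m \<noteq> 0"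
    and D: "D \<longlonglongrightarrow> 1"
    and int1: "\<And>n. clears_denom b (x * 3 ^ n) (D n * poly A1 (w n))"
    and int2: "\<And>n. clears_denom b (x * 3 ^ n) (D n * poly A2 (w n))"
    and int0: "\<And>n. clears_denom b (x * 3 ^ n) (D n * (poly A0 (w n)
        - (\<Sum>j<n + s. (poly A1 (w n) * y j + poly A2 (w n) * (y j)\<^sup>2) / (1 - (y j)\<^sup>2))))"
  shows "has_forms (G3 r) (F3 r) b r x (m * 3 ^ s)"
proof -
  define c where "c = \<bar>coeff P m\<bar>"
  have c: "c > 0" using P by (simp add: c_def)
  define L where "L w = poly A0 w + poly A1 w * G3_odd w + poly A2 w * G3_even w" for w
  have w_lim: "w \<longlonglongrightarrow> 0"
    unfolding w_def by (rule power_three_tendsto)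
  have w_nz: "w n \<noteq> 0" for n using r_nonzero by (simp add: w_def)
  have w_at: "filterlim w (at 0) sequentially"
    using w_lim w_nz by (simp add: filterlim_at)
  have "(\<lambda>n. \<bar>D n * (L (w n) / w n ^ m)\<bar>) \<longlonglongrightarrow> \<bar>1 * coeff P m\<bar>"
    unfolding L_def P_def using P(1) unfolding P_def
    by (intro tendsto_rabs tendsto_mult D filterlim_compose[OF form_tendsto w_at] m) auto
  hence lim: "(\<lambda>n. \<bar>D n * (L (w n) / w n ^ m)\<bar>) \<longlonglongrightarrow> c" by (simp add: c_def)
  have near: "\<forall>\<^sub>F n in sequentially. c / 2 < \<bar>D n * (L (w n) / w n ^ m)\<bar> \<and> \<bar>D n * (L (w n) / w n ^ m)\<bar> < 2 * c"
    using lim c by (intro eventually_conj order_tendstoD) auto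
  have bd: "\<forall>\<^sub>F n in sequentially. \<bar>D n * poly A (w n)\<bar> < \<bar>poly A 0\<bar> + 1" for A :: "real poly"
  proof (rule order_tendstoD(2))
    have "((\<lambda>n. \<bar>D n * poly A (w n)\<bar>) \<longlongrightarrow> \<bar>1 * poly A 0\<bar>) sequentially"
      by (intro tendsto_intros D w_lim)
    thus "((\<lambda>n. \<bar>D n * poly A (w n)\<bar>) \<longlongrightarrow> \<bar>poly A 0\<bar>) sequentially" by simp
  qed simp
  \<comment> \<open>The first entry bounds \<open>k1\<close> and \<open>k2\<close> together; 4 c and
    1/c come from c/2 < u < 2 c and the factor 2 in \<open>abs_form\<close>.\<close>
  define C where "C = max (\<bar>poly A1 0\<bar> + \<bar>poly A2 0\<bar> + 2) (max (4 * c) (1 / c))"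
  have C: "C > 0" using c by (simp add: C_def less_max_iff_disj)
  have "\<forall>\<^sub>F n in sequentially. \<exists>c0 c1 c2 :: int.
     \<bar>of_int c1\<bar> \<le> C * of_int b ^ (x * 3 ^ n) \<and> \<bar>of_int c2\<bar> \<le> C * of_int b ^ (x * 3 ^ n) \<and>
     \<bar>of_int c0 + of_int c1 * G3 r + of_int c2 * F3 r\<bar>
        \<le> C * (of_int b ^ (x * 3 ^ n) * \<bar>r\<bar> ^ (m * 3 ^ s * 3 ^ n)) \<and>
     of_int b ^ (x * 3 ^ n) * \<bar>r\<bar> ^ (m * 3 ^ s * 3 ^ n)
        \<le> C * \<bar>of_int c0 + of_int c1 * G3 r + of_int c2 * F3 r\<bar>"
    using bd[of A1] bd[of A2] near
  proof eventually_elim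
    case (elim n)
    define B where "B = real_of_int b ^ (x * 3 ^ n)"
    have B: "B > 0" using b by (simp add: B_def)
    define S where "S = poly A0 (w n)
        - (\<Sum>j<n + s. (poly A1 (w n) * y j + poly A2 (w n) * (y j)\<^sup>2) / (1 - (y j)\<^sup>2))"
    from int0[of n] obtain k0 where k0: "B * (D n * S) = of_int k0"
      unfolding clears_denom_def B_def S_def by (elim Ints_cases)
    from int1[of n] obtain k1 where k1: "B * (D n * poly A1 (w n)) = of_int k1"
      unfolding clears_denom_def B_def by (elim Ints_cases)
    from int2[of n] obtain k2 where k2: "B * (D n * poly A2 (w n)) = of_int k2"
      unfolding clears_denom_def B_def by (elim Ints_cases)
    have "G3_odd r = (\<Sum>j<n + s. y j / (1 - (y j)\<^sup>2)) + G3_odd (w n)"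
      using cubing_iterate[of G3_odd "\<lambda>z. z / (1 - z\<^sup>2)", OF G3_odd_rec r_less] by (simp add: y_def w_def)
    moreover have "G3_even r = (\<Sum>j<n + s. (y j)\<^sup>2 / (1 - (y j)\<^sup>2)) + G3_even (w n)"
      using cubing_iterate[of G3_even "\<lambda>z. z\<^sup>2 / (1 - z\<^sup>2)", OF G3_even_rec r_less] by (simp add: y_def w_def)
    ultimately have "L (w n) = S + poly A1 (w n) * G3_odd r + poly A2 (w n) * G3_even r"
      by (simp add: L_def S_def sum_distrib_left sum.distrib add_divide_distrib algebra_simps)
    hence "B * (D n * L (w n)) = of_int k0 + of_int k1 * G3_odd r + of_int k2 * G3_even r"
      by (simp flip: k0 k1 k2 add: algebra_simps)
    \<comment> \<open>G3 + F3 is twice the odd part and G3 - F3 twice the even part, so doubling the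
      form keeps its coefficients integral.\<close>
    hence form: "of_int (2 * k0) + of_int (k1 + k2) * G3 r + of_int (k1 - k2) * F3 r = 2 * (B * (D n * L (w n)))"
      by (simp add: F3_eq_G3[OF r_less] G3_odd_def G3_even_def algebra_simps)
    define W where "W = \<bar>r\<bar> ^ (m * 3 ^ s * 3 ^ n)"
    have W: "W = \<bar>w n\<bar> ^ m"
      by (simp add: W_def w_def power_abs power_add mult_ac flip: power_mult)
    have Wpos: "W > 0" using w_nz by (simp add: W)
    define u where "u = \<bar>D n * (L (w n) / w n ^ m)\<bar>"
    have u: "c / 2 < u" "u < 2 * c" using elim(3) by (auto simp: u_def)
    have abs_form: "\<bar>2 * (B * (D n * L (w n)))\<bar> = 2 * (B * W) * u"
      using B w_nz[of n] by (simp add: u_def W abs_mult abs_divide power_abs)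
    have BW: "B * W > 0" using B Wpos by simp
    have "\<bar>of_int k1 :: real\<bar> \<le> (\<bar>poly A1 0\<bar> + 1) * B" "\<bar>of_int k2 :: real\<bar> \<le> (\<bar>poly A2 0\<bar> + 1) * B"
      using elim(1,2) B by (simp_all flip: k1 k2 add: abs_mult mult.commute)
    hence "\<bar>of_int k1\<bar> + \<bar>of_int k2\<bar> \<le> (\<bar>poly A1 0\<bar> + \<bar>poly A2 0\<bar> + 2) * B" by (simp add: algebra_simps)
    also have "\<dots> \<le> C * B" using B by (intro mult_right_mono) (auto simp: C_def)
    finally have k12: "\<bar>of_int k1\<bar> + \<bar>of_int k2\<bar> \<le> C * B" .
    show ?case
      unfolding B_def[symmetric] W_def[symmetric]
    proof (intro exI[of _ "2 * k0"] exI[of _ "k1 + k2"] exI[of _ "k1 - k2"] conjI, unfold form abs_form)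
      show "\<bar>of_int (k1 + k2)\<bar> \<le> C * B" "\<bar>of_int (k1 - k2)\<bar> \<le> C * B" using k12 by auto
      have "2 * (B * W) * u \<le> 2 * (B * W) * (2 * c)" using u BW by (intro mult_left_mono) auto
      also have "\<dots> = (4 * c) * (B * W)" by simp
      also have "\<dots> \<le> C * (B * W)" using BW by (intro mult_right_mono) (auto simp: C_def)
      finally show "2 * (B * W) * u \<le> C * (B * W)" .
      have "(B * W) * c \<le> (B * W) * (2 * u)" using u BW by (intro mult_left_mono) auto
      hence "B * W \<le> (1 / c) * (2 * (B * W) * u)" using c by (simp add: field_simps)
      also have "\<dots> \<le> C * (2 * (B * W) * u)"
        using u c BW by (intro mult_right_mono) (auto simp: C_def)
      finally show "B * W \<le> C * (2 * (B * W) * u)" .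
    qed
  qed
  thus ?thesis unfolding has_forms_def using C by blast
qed

text \<open>
  The factor \<open>1 - r ^ (2 * 3 ^ (k - 1))\<close>, where \<open>k = n + Suc s\<close>, is a common denominator of all the
  rational functions that arise from iterating the functional equations \<open>k\<close> times.
\<close>

lemma has_forms_denom:
  fixes A0 A1 A2 :: "real poly" and m s d x :: nat
  defines "P \<equiv> A0 + A1 * G3_odd_poly + A2 * G3_even_poly"
  assumes m: "m \<le> 26" and P: "\<forall>i<m. coeff P i = 0" "coeff P m \<noteq> 0"
    and A: "\<And>i. coeff A0 i \<in> \<int>" "\<And>i. coeff A1 i \<in> \<int>" "\<And>i. coeff A2 i \<in> \<int>"
      "degree A0 \<le> d" "degree A1 \<le> d" "degree A2 \<le> d"
    and x: "x = d * 3 ^ Suc s + 2 * 3 ^ s"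
  shows "has_forms (G3 r) (F3 r) b r x (m * 3 ^ Suc s)"
proof (rule has_forms_of_poly[OF m])
  define D where "D n = 1 - r ^ (2 * 3 ^ (n + s))" for n
  \<comment> \<open>The first summand pays for polynomials of degree d at r^(3^(n + Suc s)), the
    second for \<open>D n\<close>.\<close>
  have X: "x * 3 ^ n = d * 3 ^ (n + Suc s) + 2 * 3 ^ (n + s)" for n
    by (simp add: x power_add algebra_simps)
  show "(\<lambda>n. D n) \<longlonglongrightarrow> 1"
  proof -
    have "(\<lambda>n. (r ^ 3 ^ (n + s))\<^sup>2) \<longlonglongrightarrow> 0\<^sup>2"
      by (intro tendsto_intros power_three_tendsto)
    hence "(\<lambda>n. r ^ (2 * 3 ^ (n + s))) \<longlonglongrightarrow> 0"
      by (simp add: mult.commute flip: power_mult)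
    from tendsto_diff[OF tendsto_const this, of 1] show ?thesis by (simp add: D_def)
  qed
  have cD: "clears_denom b (2 * 3 ^ (n + s)) (D n)" for n
    unfolding D_def by (intro clears_denom_diff clears_denom_power clears_denom_Ints) auto
  have poly: "clears_denom b (d * 3 ^ (n + Suc s)) (poly A (r ^ 3 ^ (n + Suc s)))"
    if "\<And>i. coeff A i \<in> \<int>" "degree A \<le> d" for A n
    using that by (rule clears_denom_poly)
  have geo: "clears_denom b (2 * 3 ^ (n + s)) (\<Sum>j<n + Suc s. D n * ((r ^ 3 ^ j) ^ e / (1 - (r ^ 3 ^ j)\<^sup>2)))"
    if e: "e \<le> 2" for n e
  proof (rule clears_denom_sum)
    fix j assume "j \<in> {..<n + Suc s}"
    then obtain k where k: "n + s = j + k" by (auto simp: less_Suc_eq_le le_iff_add)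
    define y where "y = r ^ 3 ^ j"
    have Dn: "D n = 1 - y ^ (2 * 3 ^ k)"
      by (simp add: D_def y_def k power_add mult_ac flip: power_mult)
    \<comment> \<open>As a polynomial in y, \<open>D n\<close> is divisible by 1 - y^2. Since e
      \<le> 2, the product with y^e / (1 - y^2) has degree at most that of \<open>D n\<close>, so it
      costs no further power of b.\<close>
    have "D n * (y ^ e / (1 - y\<^sup>2)) = (y ^ e - y ^ (e + 2 * 3 ^ k)) / (1 - y\<^sup>2)"
      unfolding Dn by (simp add: power_add left_diff_distrib right_diff_distrib diff_divide_distrib mult.commute)
    moreover have "clears_denom b (2 * 3 ^ (n + s)) ((y ^ e - y ^ (e + 2 * 3 ^ k)) / (1 - y\<^sup>2))"
      unfolding y_def
    proof (rule clears_denom_geometric)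
      have "3 ^ j * e \<le> 3 ^ j * 2" using e by (rule mult_le_mono2)
      thus "3 ^ j * (e + 2 * 3 ^ k) \<le> 2 * 3 ^ (n + s) + 2 * 3 ^ j"
        by (simp add: k power_add distrib_left)
    qed auto
    ultimately show "clears_denom b (2 * 3 ^ (n + s)) (D n * ((r ^ 3 ^ j) ^ e / (1 - (r ^ 3 ^ j)\<^sup>2)))"
      by (simp only: y_def)
  qed
  fix n
  let ?w = "r ^ 3 ^ (n + Suc s)"
  have DA: "clears_denom b (x * 3 ^ n) (D n * poly A ?w)"
    if "\<And>i. coeff A i \<in> \<int>" "degree A \<le> d" for A
    unfolding X using clears_denom_mult[OF cD poly[OF that]] by (simp only: add.commute)
  show "clears_denom b (x * 3 ^ n) (D n * poly A1 ?w)" "clears_denom b (x * 3 ^ n) (D n * poly A2 ?w)"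
    using DA A by auto
  have "D n * (poly A0 ?w - (\<Sum>j<n + Suc s. (poly A1 ?w * r ^ 3 ^ j + poly A2 ?w * (r ^ 3 ^ j)\<^sup>2) / (1 - (r ^ 3 ^ j)\<^sup>2)))
     = D n * poly A0 ?w - poly A1 ?w * (\<Sum>j<n + Suc s. D n * ((r ^ 3 ^ j) ^ 1 / (1 - (r ^ 3 ^ j)\<^sup>2)))
        - poly A2 ?w * (\<Sum>j<n + Suc s. D n * ((r ^ 3 ^ j) ^ 2 / (1 - (r ^ 3 ^ j)\<^sup>2)))"
    by (simp add: sum_distrib_left sum.distrib add_divide_distrib algebra_simps)
  also have "clears_denom b (x * 3 ^ n) \<dots>"
    unfolding X
    by (intro clears_denom_diff clears_denom_mult poly geo A DA[unfolded X]) auto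
  finally show "clears_denom b (x * 3 ^ n) (D n * (poly A0 ?w
      - (\<Sum>j<n + Suc s. (poly A1 ?w * r ^ 3 ^ j + poly A2 ?w * (r ^ 3 ^ j)\<^sup>2) / (1 - (r ^ 3 ^ j)\<^sup>2))))" .
qed (use P in \<open>simp_all add: P_def\<close>)

text \<open>
  If \<open>A1 + A2\<close> vanishes at 1 (for forms of a fixed parity), then \<open>A1 (y ^ M) * y + A2 (y ^ M) * y\<^sup>2\<close>
  is divisible by \<open>1 - y\<^sup>2\<close> and the common denominator can be omitted.
\<close>

lemma has_forms_no_denom:
  fixes A0 A1 A2 :: "real poly" and m s d :: nat
  defines "P \<equiv> A0 + A1 * G3_odd_poly + A2 * G3_even_poly"
  assumes m: "m \<le> 26" and P: "\<forall>i<m. coeff P i = 0" "coeff P m \<noteq> 0"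
    and A: "\<And>i. coeff A0 i \<in> \<int>" "\<And>i. coeff A1 i \<in> \<int>" "\<And>i. coeff A2 i \<in> \<int>"
      "degree A0 \<le> d" "degree A1 \<le> d" "degree A2 \<le> d"
    and div: "\<And>N M n. N > 0 \<Longrightarrow> odd M \<Longrightarrow> n = d * (M * N) \<Longrightarrow>
      clears_denom b n ((poly A1 ((r ^ N) ^ M) * r ^ N + poly A2 ((r ^ N) ^ M) * (r ^ N)\<^sup>2) / (1 - (r ^ N)\<^sup>2))"
  shows "has_forms (G3 r) (F3 r) b r (d * 3 ^ s) (m * 3 ^ s)"
proof (rule has_forms_of_poly[OF m, where D = "\<lambda>_. 1"])
  fix n
  have X: "d * 3 ^ s * 3 ^ n = d * 3 ^ (n + s)" by (simp add: power_add algebra_simps)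
  let ?w = "r ^ 3 ^ (n + s)"
  show "clears_denom b (d * 3 ^ s * 3 ^ n) (1 * poly A1 ?w)" "clears_denom b (d * 3 ^ s * 3 ^ n) (1 * poly A2 ?w)"
    unfolding X mult_1 by (intro clears_denom_poly A)+
  have "clears_denom b (d * 3 ^ (n + s)) ((poly A1 ?w * r ^ 3 ^ j + poly A2 ?w * (r ^ 3 ^ j)\<^sup>2) / (1 - (r ^ 3 ^ j)\<^sup>2))"
    if "j \<in> {..<n + s}" for j
  proof -
    \<comment> \<open>\<open>div\<close> is applied with N = 3^j and M = 3^(n + s - j). This M is
      odd, which gives paired exponents equal parity in the explicit forms.\<close>
    have j: "3 ^ (n + s) = 3 ^ (n + s - j) * (3 ^ j :: nat)" using that by (simp flip: power_add)
    hence "?w = (r ^ 3 ^ j) ^ 3 ^ (n + s - j)" by (simp add: mult.commute flip: power_mult)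
    moreover have "clears_denom b (d * 3 ^ (n + s)) ((poly A1 ((r ^ 3 ^ j) ^ 3 ^ (n + s - j)) * r ^ 3 ^ j
        + poly A2 ((r ^ 3 ^ j) ^ 3 ^ (n + s - j)) * (r ^ 3 ^ j)\<^sup>2) / (1 - (r ^ 3 ^ j)\<^sup>2))"
      using j by (intro div) auto
    ultimately show ?thesis by simp
  qed
  thus "clears_denom b (d * 3 ^ s * 3 ^ n) (1 * (poly A0 ?w
      - (\<Sum>j<n + s. (poly A1 ?w * r ^ 3 ^ j + poly A2 ?w * (r ^ 3 ^ j)\<^sup>2) / (1 - (r ^ 3 ^ j)\<^sup>2))))"
    unfolding X mult_1 by (intro clears_denom_diff clears_denom_poly clears_denom_sum A) auto
qed (use P in \<open>simp_all add: P_def\<close>)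

section \<open>Six explicit Hermite-Pade forms\<close>

text \<open>
  The coefficients of the six forms below were found by linear algebra on the Taylor coefficients.
\<close>

lemmas form_simps = G3_odd_poly_def G3_even_poly_def All_less_Suc coeff_pCons numeral_nat

text \<open>z - U + 2 z V starts with z^5: three coefficients of this parity meet two conditions, at
  z and z^3. Degree 1 with \<open>s = 0\<close> costs 1 * 3 + 2 = 5.\<close>

lemma has_forms_5_15: "has_forms (G3 r) (F3 r) b r 5 15"
proof -
  define A0 A1 A2 :: "real poly" where "A0 = [:0,1:]" and "A1 = [:-1:]" and "A2 = [:0,2:]"
  have P: "(\<forall>i<5. coeff (A0 + A1 * G3_odd_poly + A2 * G3_even_poly) i = 0) \<and>
        coeff (A0 + A1 * G3_odd_poly + A2 * G3_even_poly) 5 \<noteq> 0"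
    by (simp add: A0_def A1_def A2_def form_simps)
  have "has_forms (G3 r) (F3 r) b r 5 (5 * 3 ^ Suc 0)"
    by (rule has_forms_denom[of _ A0 A1 A2 1])
      (use P in \<open>auto simp: A0_def A1_def A2_def coeff_pCons split: nat.split\<close>)
  thus ?thesis by simp
qed

text \<open>The form is V itself, of order 2. The shift \<open>s = 1\<close> places it, with size 0
  + 2 * 3 = 6, between its neighbours in the chain.\<close>

lemma has_forms_6_18: "has_forms (G3 r) (F3 r) b r 6 18"
proof -
  define A0 A1 A2 :: "real poly" where "A0 = 0" and "A1 = 0" and "A2 = [:1:]"
  have P: "(\<forall>i<2. coeff (A0 + A1 * G3_odd_poly + A2 * G3_even_poly) i = 0) \<and>
        coeff (A0 + A1 * G3_odd_poly + A2 * G3_even_poly) 2 \<noteq> 0"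
    by (simp add: A0_def A1_def A2_def form_simps)
  have "has_forms (G3 r) (F3 r) b r 6 (2 * 3 ^ Suc 1)"
    by (rule has_forms_denom[of _ A0 A1 A2 0])
      (use P in \<open>auto simp: A0_def A1_def A2_def coeff_pCons split: nat.split\<close>)
  thus ?thesis by simp
qed

text \<open>Six coefficients of this parity meet five conditions, at z, z^3, ..., z^9.
  \<open>A1 + A2\<close> does not vanish at 1, so the denominator is paid for: 3 * 3 + 2 =
  11.\<close>

lemma has_forms_11_33: "has_forms (G3 r) (F3 r) b r 11 33"
proof -
  define A0 A1 A2 :: "real poly" where "A0 = [:0,4,0,10:]" and "A1 = [:-4,0,-1:]" and "A2 = [:0,-1,0,7:]"
  have P: "(\<forall>i<11. coeff (A0 + A1 * G3_odd_poly + A2 * G3_even_poly) i = 0) \<and>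
        coeff (A0 + A1 * G3_odd_poly + A2 * G3_even_poly) 11 \<noteq> 0"
    by (simp add: A0_def A1_def A2_def form_simps)
  have "has_forms (G3 r) (F3 r) b r 11 (11 * 3 ^ Suc 0)"
    by (rule has_forms_denom[of _ A0 A1 A2 3])
      (use P in \<open>auto simp: A0_def A1_def A2_def coeff_pCons split: nat.split\<close>)
  thus ?thesis by simp
qed

lemma has_forms_9_27: "has_forms (G3 r) (F3 r) b r 9 27"
proof -
  define A0 A1 A2 :: "real poly" where "A0 = [:0,1:]" and "A1 = [:-1:]" and "A2 = [:0,1:]"
  have P: "(\<forall>i<3. coeff (A0 + A1 * G3_odd_poly + A2 * G3_even_poly) i = 0) \<and>
        coeff (A0 + A1 * G3_odd_poly + A2 * G3_even_poly) 3 \<noteq> 0"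
    by (simp add: A0_def A1_def A2_def form_simps)
  have "has_forms (G3 r) (F3 r) b r (1 * 3 ^ 2) (3 * 3 ^ 2)"
  proof (rule has_forms_no_denom[of _ A0 A1 A2])
    fix N M n :: nat assume N: "N > 0" "odd M" "n = 1 * (M * N)"
    define y where "y = r ^ N"
    \<comment> \<open>Substitution gives -(y - y^(M + 2)). The exponents have equal parity as M is
      odd, and N (M + 2) = n + 2 N is exactly what \<open>clears_denom_geometric\<close>
      admits.\<close>
    have "(poly A1 (y ^ M) * y + poly A2 (y ^ M) * y\<^sup>2) / (1 - y\<^sup>2) = - ((y ^ 1 - y ^ (M + 2)) / (1 - y\<^sup>2))"
      unfolding minus_divide_left by (simp add: A1_def A2_def power_add power2_eq_square algebra_simps)
    also have "clears_denom b n \<dots>"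
      unfolding y_def using N by (intro clears_denom_minus clears_denom_geometric) (auto simp: algebra_simps)
    finally show "clears_denom b n ((poly A1 ((r ^ N) ^ M) * r ^ N + poly A2 ((r ^ N) ^ M) * (r ^ N)\<^sup>2) / (1 - (r ^ N)\<^sup>2))"
      by (simp add: y_def)
  qed (use P in \<open>auto simp: A0_def A1_def A2_def coeff_pCons split: nat.split\<close>)
  thus ?thesis by simp
qed

text \<open>In V - z U the terms in z^2 cancel, and z^4 survives. Among the six families this one
  has the best ratio of order to size.\<close>

lemma has_forms_9_36: "has_forms (G3 r) (F3 r) b r 9 36"
proof -
  define A0 A1 A2 :: "real poly" where "A0 = 0" and "A1 = [:0,-1:]" and "A2 = [:1:]"
  have P: "(\<forall>i<4. coeff (A0 + A1 * G3_odd_poly + A2 * G3_even_poly) i = 0) \<and>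
        coeff (A0 + A1 * G3_odd_poly + A2 * G3_even_poly) 4 \<noteq> 0"
    by (simp add: A0_def A1_def A2_def form_simps)
  have "has_forms (G3 r) (F3 r) b r (1 * 3 ^ 2) (4 * 3 ^ 2)"
  proof (rule has_forms_no_denom[of _ A0 A1 A2])
    fix N M n :: nat assume N: "N > 0" "odd M" "n = 1 * (M * N)"
    have M: "M \<ge> 1" using N by (cases M) auto
    define y where "y = r ^ N"
    have "(poly A1 (y ^ M) * y + poly A2 (y ^ M) * y\<^sup>2) / (1 - y\<^sup>2) = (y ^ 2 - y ^ (M + 1)) / (1 - y\<^sup>2)"
      by (simp add: A1_def A2_def power_add)
    also have "clears_denom b n \<dots>"
      unfolding y_def using N M by (intro clears_denom_geometric) (auto simp: algebra_simps)
    finally show "clears_denom b n ((poly A1 ((r ^ N) ^ M) * r ^ N + poly A2 ((r ^ N) ^ M) * (r ^ N)\<^sup>2) / (1 - (r ^ N)\<^sup>2))"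
      by (simp add: y_def)
  qed (use P in \<open>auto simp: A0_def A1_def A2_def coeff_pCons split: nat.split\<close>)
  thus ?thesis by simp
qed

text \<open>Twelve coefficients of this parity (\<open>A0\<close> and \<open>A2\<close> up to z^6,
  \<open>A1\<close> up to z^7) meet eleven conditions, at 1, z^2, ..., z^20. In addition
  \<open>A1 + A2\<close> vanishes at 1, which saves the denominator.\<close>

lemma has_forms_7_22: "has_forms (G3 r) (F3 r) b r 7 22"
proof -
  define A0 A1 A2 :: "real poly" where "A0 = [:0,0,0,0,0,0,6:]" and "A1 = [:0,1,0,-1,0,0,0,1:]"
    and "A2 = [:-1,0,0,0,-3,0,3:]"
  have P: "(\<forall>i<22. coeff (A0 + A1 * G3_odd_poly + A2 * G3_even_poly) i = 0) \<and>
        coeff (A0 + A1 * G3_odd_poly + A2 * G3_even_poly) 22 \<noteq> 0"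
    by (simp add: A0_def A1_def A2_def form_simps)
  have "has_forms (G3 r) (F3 r) b r (7 * 3 ^ 0) (22 * 3 ^ 0)"
  proof (rule has_forms_no_denom[of _ A0 A1 A2])
    fix N M n :: nat assume N: "N > 0" "odd M" "n = 7 * (M * N)"
    have M: "M \<ge> 1" using N by (cases M) auto
    define y where "y = r ^ N"
    have "poly A1 z = z - z ^ 3 + z ^ 7" "poly A2 z = - 1 - 3 * z ^ 4 + 3 * z ^ 6" for z
      by (simp_all add: A1_def A2_def eval_nat_numeral algebra_simps)
    hence A1: "poly A1 (y ^ M) = y ^ M - y ^ (3 * M) + y ^ (7 * M)"
      and A2: "poly A2 (y ^ M) = - 1 - 3 * y ^ (4 * M) + 3 * y ^ (6 * M)"
      by (simp_all add: mult.commute flip: power_mult)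
    \<comment> \<open>The terms are paired into differences. For odd M all six exponents are even,
      so each difference is divisible by 1 - y^2; the largest exponent 7 M + 1 stays within 7 M +
      2.\<close>
    have "(poly A1 (y ^ M) * y + poly A2 (y ^ M) * y\<^sup>2) / (1 - y\<^sup>2) =
        - ((y ^ 2 - y ^ (M + 1)) / (1 - y\<^sup>2)) - (y ^ (3 * M + 1) - y ^ (7 * M + 1)) / (1 - y\<^sup>2)
        - 3 * ((y ^ (4 * M + 2) - y ^ (6 * M + 2)) / (1 - y\<^sup>2))"
      unfolding A1 A2 by (simp add: power_add power2_eq_square add_divide_distrib diff_divide_distrib algebra_simps)
    also have "clears_denom b n \<dots>"
    proof (intro clears_denom_diff clears_denom_minus clears_denom_scale)
      show "clears_denom b n ((y ^ 2 - y ^ (M + 1)) / (1 - y\<^sup>2))"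
        unfolding y_def using N M by (intro clears_denom_geometric) (auto simp: algebra_simps)
      show "clears_denom b n ((y ^ (3 * M + 1) - y ^ (7 * M + 1)) / (1 - y\<^sup>2))"
        unfolding y_def using N M by (intro clears_denom_geometric) (auto simp: algebra_simps)
      show "clears_denom b n ((y ^ (4 * M + 2) - y ^ (6 * M + 2)) / (1 - y\<^sup>2))"
        unfolding y_def using N M by (intro clears_denom_geometric) (auto simp: algebra_simps)
    qed auto
    finally show "clears_denom b n ((poly A1 ((r ^ N) ^ M) * r ^ N + poly A2 ((r ^ N) ^ M) * (r ^ N)\<^sup>2) / (1 - (r ^ N)\<^sup>2))"
      by (simp add: y_def)
  qed (use P in \<open>auto simp: A0_def A1_def A2_def coeff_pCons split: nat.split\<close>)
  thus ?thesis by simp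
qed

end

section \<open>The chain of families and its inequalities\<close>

lemma sim_approx_exp_G3_F3_le:
  fixes a b :: int and l :: real
  assumes b: "b \<ge> 2" and a: "a \<noteq> 0" and l: "ln \<bar>real_of_int a\<bar> = l * ln (real_of_int b)"
    and l0: "0 \<le> l" and l1: "l < 19 / 29"
  shows "sim_approx_exp [G3 (of_int a / of_int b), F3 (of_int a / of_int b)] \<le> ereal (36 * (1 - l) / (19 - 29 * l))"
proof -
  define r where "r = real_of_int a / real_of_int b"
  define t where "t = 1 - l"
  have t: "10 / 29 < t" "t \<le> 1" using l0 l1 by (auto simp: t_def)
  \<comment> \<open>This is the claimed bound, since 29 t - 10 = 19 - 29 l; the condition on l makes
    this denominator positive.\<close>
  define M where "M = 36 * t / (29 * t - 10)"
  have den: "29 * t - 10 > 0" using t by simp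
  have "\<bar>real_of_int a\<bar> = exp (l * ln (real_of_int b))" using a by (simp flip: l)
  also have "\<dots> = of_int b powr l" using b by (simp add: powr_def)
  finally have r: "\<bar>r\<bar> = of_int b powr (- t)"
    using b by (simp add: r_def t_def abs_divide powr_diff)
  have "of_int b powr (- t) < of_int b powr (0 :: real)" using b t by (intro powr_less_mono) auto
  hence r1: "\<bar>r\<bar> < 1" using r b by simp
  interpret rational_point a b r by unfold_locales (use b a r1 in \<open>auto simp: r_def\<close>)
  \<comment> \<open>One cycle of the six families, ordered by increasing m; the seventh entry is
    three times the first, as \<open>period\<close> demands.\<close>
  define x m :: "nat \<Rightarrow> nat" where "x i = [5, 6, 7, 9, 11, 9, 15] ! i" and "m i = [15, 18, 22, 27, 33, 36, 45] ! i" for i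
  have all6: "P i" if "P 0" "P 1" "P 2" "P 3" "P 4" "P 5" "i < 6" for P and i :: nat
    using that by (auto simp: numeral_eq_Suc less_Suc_eq)
  have M: "M \<ge> 1" "M - 1 = (7 * t + 10) / (29 * t - 10)" using den t by (auto simp: M_def field_simps)
  \<comment> \<open>The inequalities between the coefficient sizes are quadratic in \<open>t\<close>; all but one of these
     quadratics have their minimum close to 2/7.\<close>
  have sq: "0 \<le> (t - 2 / 7) * (t - 2 / 7)" by simp
  have step: "c \<le> (u / (29 * t - 10)) * v" if "c * (29 * t - 10) \<le> u * v" for c u v :: real
    using that den by (simp add: field_simps)
  have "sim_approx_exp [G3 r, F3 r] \<le> ereal M"
  proof (rule sim_approx_exp_le_periodic[OF _ r M(1), where p = 6 and x = x and m = m])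
    fix i :: nat assume i: "i < 6"
    show "has_forms (G3 r) (F3 r) b r (x i) (m i)"
      by (rule all6[OF _ _ _ _ _ _ i]) (simp_all add: x_def m_def has_forms_5_15 has_forms_6_18
          has_forms_7_22 has_forms_9_27 has_forms_11_33 has_forms_9_36)
    \<comment> \<open>Every ratio x/m is at most 1/3, which is less than 10/29.\<close>
    show "t * m i - x i > 0"
      by (rule all6[OF _ _ _ _ _ _ i]) (use t in \<open>simp_all add: x_def m_def\<close>)
    show "x (Suc i) \<le> (M - 1) * (t * m i - x i)"
      unfolding M(2)
      by (rule step, rule all6[OF _ _ _ _ _ _ i]) (use t sq in \<open>simp_all add: x_def m_def algebra_simps\<close>)
    show "t * m (Suc i) \<le> M * (t * m i - x i)"
      unfolding M_def
    proof (rule step)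
      \<comment> \<open>With the common factor t removed, the condition is linear in t.\<close>
      have "real (m (Suc i)) * (29 * t - 10) \<le> 36 * (t * m i - x i)"
        by (rule all6[OF _ _ _ _ _ _ i]) (use t in \<open>simp_all add: x_def m_def algebra_simps\<close>)
      hence "t * (real (m (Suc i)) * (29 * t - 10)) \<le> t * (36 * (t * m i - x i))"
        using t by (intro mult_left_mono) auto
      thus "t * real (m (Suc i)) * (29 * t - 10) \<le> 36 * t * (t * m i - x i)" by (simp add: mult_ac)
    qed
  qed (use b in \<open>simp_all add: x_def m_def\<close>)
  thus ?thesis by (simp add: r_def M_def t_def algebra_simps)
qed

theorem theorem3:
  shows "(\<forall>b::int. b \<ge> 2 \<longrightarrow>
            sim_approx_exp [G3 (1 / real_of_int b), F3 (1 / real_of_int b)] \<le> ereal (36 / 19))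
       \<and> (\<forall>(a::int) (b::int) (l::real). b \<ge> 2 \<and> a \<noteq> 0 \<and>
            ln \<bar>real_of_int a\<bar> = l * ln (real_of_int b) \<and> 0 \<le> l \<and> l < 19 / 29 \<longrightarrow>
            sim_approx_exp [G3 (real_of_int a / real_of_int b), F3 (real_of_int a / real_of_int b)]
              \<le> ereal (36 * (1 - l) / (19 - 29 * l)))"
proof (intro conjI allI impI)
  fix b :: int assume "b \<ge> 2"
  thus "sim_approx_exp [G3 (1 / real_of_int b), F3 (1 / real_of_int b)] \<le> ereal (36 / 19)"
    using sim_approx_exp_G3_F3_le[of b 1 0] by simp
next
  fix a b :: int and l :: real
  assume "b \<ge> 2 \<and> a \<noteq> 0 \<and> ln \<bar>real_of_int a\<bar> = l * ln (real_of_int b) \<and> 0 \<le> l \<and> l < 19 / 29"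
  thus "sim_approx_exp [G3 (real_of_int a / real_of_int b), F3 (real_of_int a / real_of_int b)]
      \<le> ereal (36 * (1 - l) / (19 - 29 * l))"
    by (intro sim_approx_exp_G3_F3_le) auto
qed

end
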